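(* Let $T\in(0,\infty)$, $\lambda>0$, $\alpha,\nu\in(0,1]$ and $\rho\in[0,1]$, and let $N_\rho^{\alpha,\nu}(\cdot)=\{N_\rho^{\alpha,\nu}(t):t\in[0,T]\}$ be the correlated counting process $N_\rho(\cdot)$ (see context) for which the probability generating function of $M_g$ is $g(u)=E_{\nu,1}(-\lambda^\alpha T^\nu(1-u)^\alpha)$ and the common distribution function of the random variables $X_n^{F,\rho}$ is $F(t)=(t/T)^{\nu/\alpha}$ for $t\in[0,T]$. Then for every $t\in[0,T]$ and every $u\in[-1,1]$ the probability generating function $G_{N_\rho^{\alpha,\nu}(t)}(u)=\mathbb{E}\left[u^{N_\rho^{\alpha,\nu}(t)}\right]$ is $$G_{N_\rho^{\alpha,\nu}(t)}(u)=\rho\left(1-(t/T)^{\nu/\alpha}\right)+\rho(t/T)^{\nu/\alpha}E_{\nu,1}(-\lambda^\alpha T^\nu(1-u)^\alpha)+(1-\rho)E_{\nu,1}(-\lambda^\alpha t^\nu(1-u)^\alpha).$$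
   Context: Mittag-Leffler function: $E_{\alpha,\beta}(x)=\sum_{r\ge 0}\frac{x^r}{\Gamma(\alpha r+\beta)}$. Correlated counting process: for $\rho\in[0,1]$ and $T\in(0,\infty)$, $N_\rho(t)=\sum_{n=1}^{M_g}1_{[0,t]}(X_n^{F,\rho})$, $t\in[0,T]$, where $M_g$ is a nonnegative integer valued random variable with probability generating function $g(u)=\mathbb{E}[u^{M_g}]$, and $\{X_n^{F,\rho}:n\ge1\}$ is a sequence of random variables, independent of $M_g$, with common distribution function $F$ such that $F(0)=0$, $F(T)=1$, and with common pairwise correlation coefficient $\rho$. The dependence structure is the one for which, for each $t\in[0,T]$, the law of $N_\rho(t)$ has the following probability generating function (a formula recalled from the literature and used as a standing fact about these processes): $$G_{N_\rho(t)}(u)=\rho(1-F(t))+\rho F(t)g(u)+(1-\rho)g(1-F(t)+F(t)u).$$ It is known (and may be taken for granted) that the function $g$ in the claim is the probability generating function of a nonnegative integer valued random variable. *)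

theory Defs
  imports "HOL-Probability.Probability"
begin

definition mittag_leffler :: "real \<Rightarrow> real \<Rightarrow> real \<Rightarrow> real" where
  "mittag_leffler a b x = (\<Sum>r. x ^ r / Gamma (a * real r + b))"

definition pgf :: "'a measure \<Rightarrow> ('a \<Rightarrow> nat) \<Rightarrow> real \<Rightarrow> real" where
  "pgf P N u = (\<integral>\<omega>. u ^ N \<omega> \<partial>P)"

definition counting_process ::
    "('a \<Rightarrow> nat) \<Rightarrow> (nat \<Rightarrow> 'a \<Rightarrow> real) \<Rightarrow> real \<Rightarrow> 'a \<Rightarrow> nat" where
  "counting_process M X t \<omega> = (\<Sum>n = 1..M \<omega>. indicator {0..t} (X n \<omega>))"

definition (in prob_space) covariance :: "('a \<Rightarrow> real) \<Rightarrow> ('a \<Rightarrow> real) \<Rightarrow> real" where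
  "covariance Y Z =
    expectation (\<lambda>\<omega>. (Y \<omega> - expectation Y) * (Z \<omega> - expectation Z))"

definition (in prob_space) correlation :: "('a \<Rightarrow> real) \<Rightarrow> ('a \<Rightarrow> real) \<Rightarrow> real" where
  "correlation Y Z = covariance Y Z / (sqrt (variance Y) * sqrt (variance Z))"

text \<open>
  The sequence \<open>X\<close> is indexed from 1; the value \<open>X 0\<close> is irrelevant. The distribution
  function \<open>F\<close> is only constrained on \<open>{0..T}\<close>, which determines the law of each
  \<open>X n\<close> because \<open>F 0 = 0\<close> and \<open>F T = 1\<close>.

  The pairwise correlations alone do not determine the joint law of \<open>X\<close>. The dependence
  structure enters through \<open>pgf_counting\<close>, the formula for the probability generating
  function of the counting process at a fixed time, which is part of the description of these
  processes. It holds, for instance, if with probability \<open>\<rho>\<close> all the \<open>X n\<close>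
  coincide and otherwise they are independent, the choice being independent of \<open>M\<close>.

  The independence of \<open>M\<close> and the sequence \<open>X\<close> is stated with the generated
  \<open>\<sigma>\<close>-algebras because \<open>indep_var\<close> requires both variables to have the same
  type of values.
\<close>

locale correlated_counting_process = prob_space P
  for P :: "'a measure" +
  fixes T \<rho> :: real
    and F :: "real \<Rightarrow> real"
    and M :: "'a \<Rightarrow> nat"
    and X :: "nat \<Rightarrow> 'a \<Rightarrow> real"
  assumes T_pos: "T > 0"
    and rho_range: "\<rho> \<in> {0..1}"
    and M_measurable: "random_variable (count_space UNIV) M"
    and X_measurable: "\<And>n. n \<ge> 1 \<Longrightarrow> random_variable borel (X n)"
    and indep_M_X:
      "indep_set (sets (vimage_algebra (space P) M (count_space UNIV)))
        (sets (vimage_algebra (space P) (\<lambda>\<omega>. \<lambda>n\<in>{1..}. X n \<omega>) (PiM {1..} (\<lambda>_. borel))))"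
    and cdf_X: "\<And>n t. n \<ge> 1 \<Longrightarrow> t \<in> {0..T} \<Longrightarrow> cdf (distr P borel (X n)) t = F t"
    and F_0: "F 0 = 0"
    and F_T: "F T = 1"
    and correlation_X:
      "\<And>m n. m \<ge> 1 \<Longrightarrow> n \<ge> 1 \<Longrightarrow> m \<noteq> n \<Longrightarrow> correlation (X m) (X n) = \<rho>"
    and pgf_counting:
      "\<And>t u. t \<in> {0..T} \<Longrightarrow> u \<in> {-1..1} \<Longrightarrow>
        pgf P (counting_process M X t) u =
          \<rho> * (1 - F t) + \<rho> * F t * pgf P M u + (1 - \<rho>) * pgf P M (1 - F t + F t * u)"

end

theory Submission
  imports Defs
begin

text \<open>\<open>pgf_counting\<close> already splits the generating function into the stated
  terms, so only its last one, \<open>pgf P M\<close> at \<open>w = 1 - F t + F t * u\<close>, has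
  to be evaluated. There \<open>1 - w = F t * (1 - u)\<close>, and the exponent \<nu>/\<alpha> in
  \<open>F\<close> is what makes the \<alpha>-th power of \<open>F t\<close> equal to (t/T)^\<nu>.
  This turns the factor T^\<nu> of the Mittag-Leffler argument into t^\<nu>.\<close>

theorem proposition2p1:
  fixes P :: "'a measure"
    and T lam \<alpha> \<nu> \<rho> :: real
    and F :: "real \<Rightarrow> real"
    and M :: "'a \<Rightarrow> nat"
    and X :: "nat \<Rightarrow> 'a \<Rightarrow> real"
    and t u :: real
  assumes "T > 0"
    and "lam > 0"
    and "\<alpha> \<in> {0<..1}"
    and "\<nu> \<in> {0<..1}"
    and "\<rho> \<in> {0..1}"
    and "correlated_counting_process P T \<rho> F M X"
    and "\<And>v. v \<in> {-1..1} \<Longrightarrow>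
      pgf P M v = mittag_leffler \<nu> 1 (- (lam powr \<alpha> * T powr \<nu> * (1 - v) powr \<alpha>))"
    and "\<And>s. s \<in> {0..T} \<Longrightarrow> F s = (s / T) powr (\<nu> / \<alpha>)"
    and "t \<in> {0..T}"
    and "u \<in> {-1..1}"
  shows "pgf P (counting_process M X t) u =
      \<rho> * (1 - (t / T) powr (\<nu> / \<alpha>))
      + \<rho> * (t / T) powr (\<nu> / \<alpha>)
          * mittag_leffler \<nu> 1 (- (lam powr \<alpha> * T powr \<nu> * (1 - u) powr \<alpha>))
      + (1 - \<rho>) * mittag_leffler \<nu> 1 (- (lam powr \<alpha> * t powr \<nu> * (1 - u) powr \<alpha>))"
proof -
  interpret correlated_counting_process P T \<rho> F M X by fact
  define w where "w = 1 - F t + F t * u"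
  have F_t: "F t = (t / T) powr (\<nu> / \<alpha>)" and t: "0 \<le> t" "t / T \<le> 1"
    using assms(1,8,9) by auto
  have "F t \<in> {0..1}"
    using t assms(1,3,4) by (auto simp: F_t intro!: powr_le1)
  \<comment> \<open>These bounds on \<open>1 - w\<close> place \<open>w\<close> in [-1,1], the only
    range where the formula for \<open>pgf P M\<close> is assumed.\<close>
  then have "0 \<le> F t * (1 - u)" "F t * (1 - u) \<le> 1 * 2"
    using assms(10) by (simp, intro mult_mono) auto
  moreover have w: "1 - w = F t * (1 - u)"
    by (simp add: w_def algebra_simps)
  ultimately have w_range: "w \<in> {-1..1}"
    by auto
  \<comment> \<open>The exponents combine as (\<nu>/\<alpha>) * \<alpha> = \<nu>, which uses
    \<alpha> > 0.\<close>
  have "T powr \<nu> * (1 - w) powr \<alpha> = T powr \<nu> * ((t / T) powr \<nu> * (1 - u) powr \<alpha>)"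
    using assms(3,10) by (simp add: w F_t powr_mult powr_powr)
  \<comment> \<open>No case split at t = 0: both sides vanish there, since
    \<open>0 powr \<nu> = 0\<close>.\<close>
  also have "\<dots> = t powr \<nu> * (1 - u) powr \<alpha>"
    using assms(1) t by (simp add: powr_divide)
  finally have "pgf P M w = mittag_leffler \<nu> 1 (- (lam powr \<alpha> * t powr \<nu> * (1 - u) powr \<alpha>))"
    using assms(7)[OF w_range] by (simp add: mult.assoc)
  then show ?thesis
    using pgf_counting[OF assms(9,10)] assms(7)[OF assms(10)] by (simp add: w_def F_t)
qed

end
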